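(* Consider the purely implicit scalar test equation $u_t=\lambda u$, i.e. $\mathcal{F}=0$, $\mathcal{G}(u)=\lambda u$, $\dot{\mathcal{G}}(u)=\lambda^2u$, with $\lambda\in\mathbb{C}$ and $z=\lambda\Delta t$. One step of the two-stage method is then $u^{n+1}=R_{\rm Pro}(z)\,u^n$ with stability function $$R_{\rm Pro}(z)=\frac{1-\frac{z}{2}-\frac{5z^2}{24}}{\left(1-\frac{z}{2}+\frac{z^2}{8}\right)\left(1-z+\frac{z^2}{6}\right)}.$$ As $z\to-\infty$ along the real axis, $$R_{\rm Pro}(z)=-\frac{10}{z^2}+\mathcal{O}(z^{-3}),$$ so that $R_{\rm Pro}(z)=\mathcal{O}(z^{-2})$, and the method is L-stable.
   Context: The two-stage method for a split system $\frac{du}{dt}=\mathcal{F}(u)+\mathcal{G}(u)$, with $\dot{\mathcal{F}}=\mathcal{F}_u(\mathcal{F}+\mathcal{G})$ and $\dot{\mathcal{G}}=\mathcal{G}_u(\mathcal{F}+\mathcal{G})$ (subscript $u$ denoting the Jacobian/derivative), advances $u^n$ to $u^{n+1}$ with time step $\Delta t>0$ by $$u^*=u^n+\frac{\Delta t}{2}\mathcal{F}(u^n)+\frac{\Delta t^2}{8}\dot{\mathcal{F}}(u^n)+\frac{\Delta t}{2}\mathcal{G}(u^* )-\frac{\Delta t^2}{8}\dot{\mathcal{G}}(u^* ),$$ $$u^{n+1}=u^n+\Delta t\,\mathcal{F}(u^n)+\frac{\Delta t^2}{6}\left[\dot{\mathcal{F}}(u^n)+2\dot{\mathcal{F}}(u^*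 )\right]+\Delta t\,\mathcal{G}(u^{n+1})-\frac{\Delta t^2}{6}\left[\dot{\mathcal{G}}(u^{n+1})+2\dot{\mathcal{G}}(u^* )\right].$$ The formula for the step applies whenever the denominators do not vanish, in particular for all $z$ with $\operatorname{Re}(z)\le 0$. A method with stability function $R$ is A-stable if $|R(z)|\le1$ for all $z\in\mathbb{C}$ with $\operatorname{Re}(z)\le0$, and L-stable if it is A-stable and $R(z)\to0$ as $|z|\to\infty$. *)

theory Defs
  imports "HOL-Analysis.Analysis" "HOL-Library.Landau_Symbols"
begin

text \<open>For a solution of \<open>u' = F u + G u\<close>, the time derivative of \<open>H u\<close> is
  \<open>H\<^sub>u (F u + G u)\<close>. It is meaningful only where \<open>H\<close> is differentiable:
  otherwise \<^const>\<open>frechet_derivative\<close> is an arbitrary function.\<close>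

definition time_deriv ::
  "('a::real_normed_vector \<Rightarrow> 'a) \<Rightarrow> ('a \<Rightarrow> 'a) \<Rightarrow> ('a \<Rightarrow> 'a) \<Rightarrow> 'a \<Rightarrow> 'a" where
  "time_deriv F G H u = frechet_derivative H (at u) (F u + G u)"

text \<open>Both stages are implicit, so a step is a relation between \<open>u\<^sup>n\<close> (here \<open>u\<close>)
  and \<open>u\<^sup>n\<^sup>+\<^sup>1\<close> (here \<open>v\<close>); \<open>w\<close> is the intermediate stage \<open>u\<^sup>*\<close>.\<close>

definition two_stage_step ::
  "('a::real_normed_vector \<Rightarrow> 'a) \<Rightarrow> ('a \<Rightarrow> 'a) \<Rightarrow> real \<Rightarrow> 'a \<Rightarrow> 'a \<Rightarrow> bool" where
  "two_stage_step F G dt u v \<longleftrightarrow>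
    (\<exists>w.
      w = u + (dt / 2) *\<^sub>R F u + (dt\<^sup>2 / 8) *\<^sub>R time_deriv F G F u
            + (dt / 2) *\<^sub>R G w - (dt\<^sup>2 / 8) *\<^sub>R time_deriv F G G w \<and>
      v = u + dt *\<^sub>R F u
            + (dt\<^sup>2 / 6) *\<^sub>R (time_deriv F G F u + 2 *\<^sub>R time_deriv F G F w)
            + dt *\<^sub>R G v
            - (dt\<^sup>2 / 6) *\<^sub>R (time_deriv F G G v + 2 *\<^sub>R time_deriv F G G w))"

definition R_Pro :: "complex \<Rightarrow> complex" where
  "R_Pro z = (1 - z / 2 - 5 * z\<^sup>2 / 24) / ((1 - z / 2 + z\<^sup>2 / 8) * (1 - z + z\<^sup>2 / 6))"

definition A_stable :: "(complex \<Rightarrow> complex) \<Rightarrow> bool" where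
  "A_stable R \<longleftrightarrow> (\<forall>z. Re z \<le> 0 \<longrightarrow> cmod (R z) \<le> 1)"

definition L_stable :: "(complex \<Rightarrow> complex) \<Rightarrow> bool" where
  "L_stable R \<longleftrightarrow> A_stable R \<and> (R \<longlongrightarrow> 0) at_infinity"

end

(* On the closed left half-plane write z = - a + i y with a >= 0. The squared modulus of the
   denominator of R_Pro minus that of its numerator is then a polynomial in a and y^2 all of whose
   coefficients are nonnegative. This gives A-stability directly, without the maximum principle. *)
theory Submission
  imports Defs "HOL-Real_Asymp.Real_Asymp"
begin

text \<open>With \<open>z = - a + i y\<close>, the imaginary parts are
  \<open>- y * (2 + a) / 4\<close> and \<open>- y * (3 + a) / 3\<close>, so for a \<ge> 0 a zero
  would have to be real. On the real half-line each factor is 1 plus nonnegative terms.\<close>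

lemma R_Pro_denominators_nonzero:
  fixes z :: complex
  assumes "Re z \<le> 0"
  shows "1 - z / 2 + z\<^sup>2 / 8 \<noteq> 0" and "1 - z + z\<^sup>2 / 6 \<noteq> 0"
proof -
  obtain a y where z: "z = Complex (- a) y" and a: "a \<ge> 0"
    using assms by (metis complex_surj minus_minus neg_0_le_iff_le)
  show "1 - z / 2 + z\<^sup>2 / 8 \<noteq> 0"
  proof
    assume "1 - z / 2 + z\<^sup>2 / 8 = 0"
    then have re: "1 + a / 2 + (a\<^sup>2 - y\<^sup>2) / 8 = 0" and im: "y * (2 + a) = 0"
      by (auto simp: z complex_eq_iff power2_eq_square field_simps)
    from im a have "y = 0" by auto
    moreover have "1 + a / 2 + a\<^sup>2 / 8 > 0" using a by (intro add_pos_nonneg) auto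
    ultimately show False using re by simp
  qed
  show "1 - z + z\<^sup>2 / 6 \<noteq> 0"
  proof
    assume "1 - z + z\<^sup>2 / 6 = 0"
    then have re: "1 + a + (a\<^sup>2 - y\<^sup>2) / 6 = 0" and im: "y * (3 + a) = 0"
      by (auto simp: z complex_eq_iff power2_eq_square field_simps)
    from im a have "y = 0" by auto
    moreover have "1 + a + a\<^sup>2 / 6 > 0" using a by (intro add_pos_nonneg) auto
    ultimately show False using re by simp
  qed
qed

lemma A_stable_R_Pro: "A_stable R_Pro"
  unfolding A_stable_def
proof (intro allI impI)
  fix z :: complex
  assume z0: "Re z \<le> 0"
  define N where "N = 1 - z / 2 - 5 * z\<^sup>2 / 24"
  define D1 where "D1 = 1 - z / 2 + z\<^sup>2 / 8"
  define D2 where "D2 = 1 - z + z\<^sup>2 / 6"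
  define a where "a = - Re z"
  define s where "s = (Im z)\<^sup>2"
  have z: "Re z = - a" and a: "a \<ge> 0" and s: "s \<ge> 0"
    using z0 by (auto simp: a_def s_def)
  \<comment> \<open>The real parts involve \<open>Im z\<close> only through its square and the
    imaginary parts are \<open>Im z\<close> times a polynomial in \<open>a\<close>, so every squared
    modulus is a polynomial in \<open>a\<close> and \<open>s\<close>.\<close>
  have N: "(cmod N)\<^sup>2 = (1 + a / 2 - 5 * (a\<^sup>2 - s) / 24)\<^sup>2 + s * (5 * a / 12 - 1 / 2)\<^sup>2"
    unfolding cmod_power2 N_def s_def by (simp add: z field_simps power2_eq_square)
  have D1: "(cmod D1)\<^sup>2 = (1 + a / 2 + (a\<^sup>2 - s) / 8)\<^sup>2 + s * (a / 4 + 1 / 2)\<^sup>2"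
    unfolding cmod_power2 D1_def s_def by (simp add: z field_simps power2_eq_square)
  have D2: "(cmod D2)\<^sup>2 = (1 + a + (a\<^sup>2 - s) / 6)\<^sup>2 + s * (a / 3 + 1)\<^sup>2"
    unfolding cmod_power2 D2_def s_def by (simp add: z field_simps power2_eq_square)
  \<comment> \<open>Full expansion of the difference. On the imaginary axis, \<open>a = 0\<close>,
    all powers of \<open>s\<close> below the third cancel.\<close>
  have "(cmod D1)\<^sup>2 * (cmod D2)\<^sup>2 - (cmod N)\<^sup>2 =
    1 / 96 * s ^ 3 + 1 / 2304 * s ^ 4 + 2 * a + 4 / 3 * a * s + 41 / 288 * a * s ^ 2 +
    5 / 576 * a * s ^ 3 + 4 * a ^ 2 + 11 / 12 * a ^ 2 * s + 7 / 72 * a ^ 2 * s ^ 2 +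
    1 / 576 * a ^ 2 * s ^ 3 + 3 * a ^ 3 + 77 / 144 * a ^ 3 * s + 5 / 192 * a ^ 3 * s ^ 2 +
    5 / 4 * a ^ 4 + 47 / 288 * a ^ 4 * s + 1 / 384 * a ^ 4 * s ^ 2 + 113 / 288 * a ^ 5 +
    5 / 192 * a ^ 5 * s + 11 / 144 * a ^ 6 + 1 / 576 * a ^ 6 * s + 5 / 576 * a ^ 7 +
    1 / 2304 * a ^ 8"
    unfolding N D1 D2 by (simp add: field_simps power_numeral_reduce power2_eq_square)
  also have "\<dots> \<ge> 0"
    using a s by (intro add_nonneg_nonneg mult_nonneg_nonneg zero_le_power) auto
  finally have "(cmod N)\<^sup>2 \<le> (cmod (D1 * D2))\<^sup>2"
    by (simp add: norm_mult power_mult_distrib)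
  then have "cmod N \<le> cmod (D1 * D2)"
    by (rule power2_le_imp_le) simp
  \<comment> \<open>A vanishing denominator is covered by the convention
    \<open>x / 0 = 0\<close>.\<close>
  then have "cmod (N / (D1 * D2)) \<le> 1"
    by (auto simp: norm_divide divide_le_eq_1)
  then show "cmod (R_Pro z) \<le> 1"
    by (simp add: R_Pro_def N_def D1_def D2_def)
qed

text \<open>The substitution \<open>w = inverse z\<close> turns the limit at infinity into
  continuity at 0. Dividing the numerator and both quadratic factors by \<open>z\<^sup>2\<close>
  leaves one spare factor \<open>w\<^sup>2\<close>, so \<open>g 0 = 0\<close>, while the denominator
  of \<open>g\<close> at 0 is 1/48.\<close>

lemma R_Pro_tendsto_0: "(R_Pro \<longlongrightarrow> 0) at_infinity"
proof -
  define g where "g w = w\<^sup>2 * (w\<^sup>2 - w / 2 - 5 / 24) / ((w\<^sup>2 - w / 2 + 1 / 8) * (w\<^sup>2 - w + 1 / 6))"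
    for w :: complex
  have eq: "g (inverse z) = R_Pro z" if "z \<noteq> 0" for z
  proof -
    have 1: "(inverse z)\<^sup>2 - inverse z / 2 - 5 / 24 = (1 - z / 2 - 5 * z\<^sup>2 / 24) / z\<^sup>2"
      "(inverse z)\<^sup>2 - inverse z / 2 + 1 / 8 = (1 - z / 2 + z\<^sup>2 / 8) / z\<^sup>2"
      "(inverse z)\<^sup>2 - inverse z + 1 / 6 = (1 - z + z\<^sup>2 / 6) / z\<^sup>2"
      using that by (simp_all add: field_simps power2_eq_square)
    have 2: "(inverse z)\<^sup>2 = 1 / z\<^sup>2"
      by (simp add: power2_eq_square inverse_eq_divide)
    \<comment> \<open>Applied with \<open>k\<close> the square of \<open>z\<close>; keeping the
      polynomials opaque avoids expanding them.\<close>
    have cancel: "1 / k * (n / k) / ((d / k) * (e / k)) = n / (d * e)" if "k \<noteq> 0"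
      for k n d e :: complex
      using that by simp
    show ?thesis
      unfolding g_def 1 R_Pro_def unfolding 2 using that by (intro cancel) simp
  qed
  have "isCont g 0"
    unfolding g_def by (intro continuous_intros) auto
  \<comment> \<open>\<open>tendsto_inverse_0\<close> lands in \<open>nhds 0\<close>, so the limit is
    restated on the full neighbourhood, centre included.\<close>
  then have "(g \<longlongrightarrow> g 0) (nhds 0)"
    by (simp add: continuous_at_imp_continuous_on isCont_def tendsto_at_iff_tendsto_nhds)
  from filterlim_compose[OF this tendsto_inverse_0]
  have "((\<lambda>z. g (inverse z)) \<longlongrightarrow> 0) at_infinity"
    by (simp add: g_def)
  then show ?thesis
    by (rule Lim_transform_eventually)
      (use eventually_not_equal_at_infinity[of "0 :: complex"] in \<open>auto elim!: eventually_mono simp: eq\<close>)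
qed

lemma time_deriv_linear:
  fixes lam u :: complex
  shows "time_deriv (\<lambda>_. 0) (\<lambda>u. lam * u) (\<lambda>u. lam * u) u = lam\<^sup>2 * u"
proof -
  have "((\<lambda>u. lam * u) has_derivative (\<lambda>h. lam * h)) (at u)"
    by (auto intro!: derivative_eq_intros)
  then have "frechet_derivative (\<lambda>u. lam * u) (at u) = (\<lambda>h. lam * h)"
    by (rule frechet_derivative_at [symmetric])
  then show ?thesis
    by (simp add: time_deriv_def power2_eq_square)
qed

text \<open>For the linear test equation each implicit stage is a scalar linear equation, uniquely
  solvable because its factor is nonzero. The first gives \<open>w = u / ?D1\<close>; inserting this
  into the second leaves \<open>v\<close> as a multiple of \<open>u\<close>.\<close>

lemma two_stage_step_linear_iff:
  fixes lam u v z :: complex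
  assumes z: "z = lam * of_real dt"
    and D1: "1 - z / 2 + z\<^sup>2 / 8 \<noteq> 0" and D2: "1 - z + z\<^sup>2 / 6 \<noteq> 0"
  shows "two_stage_step (\<lambda>_. 0) (\<lambda>u. lam * u) dt u v \<longleftrightarrow> v = R_Pro z * u"
proof -
  have zero: "time_deriv (\<lambda>_. 0) (\<lambda>u. lam * u) (\<lambda>_. 0) x = 0" for x :: complex
    by (simp add: time_deriv_def)
  let ?D1 = "1 - z / 2 + z\<^sup>2 / 8" and ?D2 = "1 - z + z\<^sup>2 / 6"
  have stage1: "w = u + (dt / 2) *\<^sub>R (lam * w) - (dt\<^sup>2 / 8) *\<^sub>R (lam\<^sup>2 * w) \<longleftrightarrow> w = u / ?D1" for w
  proof -
    have "w = u + (dt / 2) *\<^sub>R (lam * w) - (dt\<^sup>2 / 8) *\<^sub>R (lam\<^sup>2 * w) \<longleftrightarrow> ?D1 * w = u"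
      unfolding z by (auto simp: scaleR_conv_of_real algebra_simps)
    with D1 show ?thesis by (simp add: eq_divide_eq mult.commute)
  qed
  have stage2: "v = u + dt *\<^sub>R (lam * v) - (dt\<^sup>2 / 6) *\<^sub>R (lam\<^sup>2 * v + 2 *\<^sub>R (lam\<^sup>2 * w)) \<longleftrightarrow>
      v = (u - z\<^sup>2 / 3 * w) / ?D2" for w
  proof -
    have "v = u + dt *\<^sub>R (lam * v) - (dt\<^sup>2 / 6) *\<^sub>R (lam\<^sup>2 * v + 2 *\<^sub>R (lam\<^sup>2 * w)) \<longleftrightarrow>
        ?D2 * v = u - z\<^sup>2 / 3 * w"
      unfolding z by (auto simp: scaleR_conv_of_real algebra_simps)
    with D2 show ?thesis by (simp add: eq_divide_eq mult.commute)
  qed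
  have "u - z\<^sup>2 / 3 * (u / ?D1) = (?D1 - z\<^sup>2 / 3) * u / ?D1"
  proof -
    have "u - c * (u / d) = (d - c) * u / d" if "d \<noteq> 0" for c d :: complex
      using that by (simp add: field_simps)
    from this[OF D1] show ?thesis .
  qed
  \<comment> \<open>The coefficient -5/24 of the numerator arises as 1/8 - 1/3.\<close>
  also have "?D1 - z\<^sup>2 / 3 = 1 - z / 2 - 5 * z\<^sup>2 / 24"
    by (simp add: field_simps)
  finally have step: "(u - z\<^sup>2 / 3 * (u / ?D1)) / ?D2 = R_Pro z * u"
    by (simp add: R_Pro_def)
  have "two_stage_step (\<lambda>_. 0) (\<lambda>u. lam * u) dt u v \<longleftrightarrow>
      (\<exists>w. w = u / ?D1 \<and> v = (u - z\<^sup>2 / 3 * w) / ?D2)"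
    by (simp only: two_stage_step_def zero time_deriv_linear stage1 stage2 scaleR_zero_right add_0_right)
  \<comment> \<open>The intermediate stage is determined by \<open>u\<close>, so the one-point rule
    removes the existential.\<close>
  then show ?thesis
    by (simp only: step simp_thms)
qed

text \<open>All coefficients are real, so the asymptotics along the real axis reduce to those of a
  real rational function, which \<open>real_asymp\<close> handles; the results are then carried back
  through \<open>of_real\<close>.\<close>

lemma R_Pro_of_real:
  "R_Pro (of_real x) = of_real ((1 - x / 2 - 5 * x\<^sup>2 / 24) / ((1 - x / 2 + x\<^sup>2 / 8) * (1 - x + x\<^sup>2 / 6)))"
  by (simp add: R_Pro_def)

text \<open>The constant -10 is the quotient of the leading coefficients, -5/24 over 1/48, of a
  quadratic and a quartic; the remainder is one order smaller.\<close>

lemma R_Pro_real_asymptotics: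
  "(\<lambda>x :: real. R_Pro (of_real x) - (- 10 / (of_real x)\<^sup>2)) \<in> O[at_bot](\<lambda>x. 1 / (of_real x) ^ 3)"
proof -
  have "(\<lambda>x :: real. (1 - x / 2 - 5 * x\<^sup>2 / 24) / ((1 - x / 2 + x\<^sup>2 / 8) * (1 - x + x\<^sup>2 / 6)) - (- 10 / x\<^sup>2))
      \<in> O[at_bot](\<lambda>x. 1 / x ^ 3)"
    by real_asymp
  then have "(\<lambda>x. of_real ((1 - x / 2 - 5 * x\<^sup>2 / 24) / ((1 - x / 2 + x\<^sup>2 / 8) * (1 - x + x\<^sup>2 / 6)) - (- 10 / x\<^sup>2)) :: complex)
      \<in> O[at_bot](\<lambda>x :: real. of_real (1 / x ^ 3) :: complex)"
    by (subst landau_o.big.of_real_iff)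
  then show ?thesis
    by (simp add: R_Pro_of_real)
qed

lemma R_Pro_real_bigo:
  "(\<lambda>x :: real. R_Pro (of_real x)) \<in> O[at_bot](\<lambda>x. 1 / (of_real x)\<^sup>2)"
proof -
  have "(\<lambda>x :: real. (1 - x / 2 - 5 * x\<^sup>2 / 24) / ((1 - x / 2 + x\<^sup>2 / 8) * (1 - x + x\<^sup>2 / 6)))
      \<in> O[at_bot](\<lambda>x. 1 / x\<^sup>2)"
    by real_asymp
  then have "(\<lambda>x. of_real ((1 - x / 2 - 5 * x\<^sup>2 / 24) / ((1 - x / 2 + x\<^sup>2 / 8) * (1 - x + x\<^sup>2 / 6))) :: complex)
      \<in> O[at_bot](\<lambda>x :: real. of_real (1 / x\<^sup>2) :: complex)"
    by (subst landau_o.big.of_real_iff)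
  then show ?thesis
    by (simp add: R_Pro_of_real)
qed

theorem mainTheorem2:
  shows "(\<forall>lam u :: complex.
           time_deriv (\<lambda>_. 0) (\<lambda>u. lam * u) (\<lambda>u. lam * u) u = lam\<^sup>2 * u) \<and>
         (\<forall>z :: complex. Re z \<le> 0 \<longrightarrow>
           1 - z / 2 + z\<^sup>2 / 8 \<noteq> 0 \<and> 1 - z + z\<^sup>2 / 6 \<noteq> 0) \<and>
         (\<forall>(lam :: complex) (dt :: real) (z :: complex) (u :: complex) (v :: complex).
           dt > 0 \<longrightarrow> z = lam * of_real dt \<longrightarrow>
           1 - z / 2 + z\<^sup>2 / 8 \<noteq> 0 \<longrightarrow> 1 - z + z\<^sup>2 / 6 \<noteq> 0 \<longrightarrow>
           (two_stage_step (\<lambda>_. 0) (\<lambda>u. lam * u) dt u v \<longleftrightarrow> v = R_Pro z * u)) \<and>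
         (\<lambda>x :: real. R_Pro (of_real x) - (- 10 / (of_real x)\<^sup>2))
           \<in> O[at_bot](\<lambda>x. 1 / (of_real x) ^ 3) \<and>
         (\<lambda>x :: real. R_Pro (of_real x)) \<in> O[at_bot](\<lambda>x. 1 / (of_real x)\<^sup>2) \<and>
         L_stable R_Pro"
  using time_deriv_linear R_Pro_denominators_nonzero two_stage_step_linear_iff
    R_Pro_real_asymptotics R_Pro_real_bigo A_stable_R_Pro R_Pro_tendsto_0
  unfolding L_stable_def by blast

end
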